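(* For every term $M \in \Lambda_{vr}$ (the call-by-value $\lambda$-calculus with external, possibly store-modifying, function constants), one has $M \simeq \mathcal{C}(M)$, where $\mathcal{C}$ is the variable elimination algorithm $(fa_vb)$ translating terms into combinations of the combinators $\mathsf{S}$, $\mathsf{K}$, $\mathsf{I}$, and $\simeq$ is term equivalence.
   Context: **Terms.** Let $\mathit{Vars}$ be an infinite set of variables and $\mathit{FunConsts}$ a set of constants (external function symbols). The sets $\mathit{Vals}$ of values $V$ and $\Lambda_{vr}$ of terms $M$ are defined by mutual induction, with $x\in\mathit{Vars}$ and $a_f\in\mathit{FunConsts}$: $$V ::= x \mid \lambda x.M \mid a_f, \qquad M ::= V \mid (M~M).$$ So variables, abstractions and constants are values, and only applications are not values. $[V/x]M$ denotes the usual capture-avoiding substitution of $V$ for the free occurrences of $x$ in $M$, with automatic renaming of bound variables when needed (Barendregt's variable convention is not assumed). **Stores.** Let $\mathit{St}$ be an arbitrary (abstract) set of stores, let $F_{\mathit{St}}$ be a set of total functions $\mathit{Vals}\times \mathit{St}\to \mathit{Vals}\times \mathit{St}$, and let $\delta:\mathit{FunConsts}\to F_{\mathit{St}}$ be an arbitrary total function. No further properties are required. $\sigma,\sigma_1,\sigma_2$ range over $\mathit{St}$. **Reduction.** The relation $M_1/\sigma_1\longrightarrow M_2/\sigma_2$ between pairs (term, store) is defined inductively by the following rules, where $V, V_1, V_2$ are values and $M, M_1, M_2$ are terms: - $(\beta_{vr})$: $((\lambda x.M)~V)/\sigma\longrightarrow [V/x]M/\sigma$; - (Left): if $M_1/\sigma_1\longrightarrow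 M_2/\sigma_2$ then $(M_1~M)/\sigma_1\longrightarrow (M_2~M)/\sigma_2$; - (Right): if $M_1/\sigma_1\longrightarrow M_2/\sigma_2$ then $(V~M_1)/\sigma_1\longrightarrow (V~M_2)/\sigma_2$; - $(\delta)$: if $(V_2,\sigma_2)=\delta(a_f)(V_1,\sigma_1)$ then $(a_f~V_1)/\sigma_1\longrightarrow V_2/\sigma_2$. **Equivalence.** The relation $\simeq$ on $\Lambda_{vr}$ is defined inductively by the following rules: - reflexivity: $M\simeq M$; symmetry: if $M\simeq N$ then $N\simeq M$; transitivity: if $M_1\simeq M_2$ and $M_2\simeq M_3$ then $M_1\simeq M_3$; - compatibility: if $M_1\simeq M_2$ then $(M_1~N)\simeq(M_2~N)$ and $(N~M_1)\simeq (N~M_2)$; - $(\beta_{vr}\text{-eq})$: if for all stores $\sigma$, $M_1/\sigma\longrightarrow M_2/\sigma$, then $M_1\simeq M_2$; - $(\xi)$: if $M_1\simeq M_2$ then $\lambda x.M_1\simeq\lambda x.M_2$; - $(\zeta')$: if $((\lambda x_1.M_1)~y)\simeq((\lambda x_2.M_2)~y)$, where the variable $y$ is not free in $\lambda x_1.M_1$ and not free in $\lambda x_2.M_2$, then $\lambda x_1.M_1\simeq\lambda x_2.M_2$. **Combinators.** Fix three distinct particular variables $x,y,z\in\mathit{Vars}$. The combinators are the terms $\mathsf{I}=\lambda x.x$, $\mathsf{K}=\lambda x.\lambda y.x$, $\mathsf{S}=\lambda x.\lambda y.\lambda z.((x~z)~(y~z))$. **Variable elimination.** Below, $x,y$ range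 over arbitrary variables. The function $\mathcal{D}(x,M)$ is defined for a variable $x$ and a term $M$ built by application from variables, constants $a_f$, and the terms $\mathsf{I},\mathsf{K},\mathsf{S}$, by: - $\mathcal{D}(x,x)=\mathsf{I}$; - $\mathcal{D}(x,y)=(\mathsf{K}~y)$ if $x\neq y$; - $\mathcal{D}(x,c)=(\mathsf{K}~c)$ if $c$ is $\mathsf{I}$, $\mathsf{K}$, $\mathsf{S}$ or a constant $a_f$; - $\mathcal{D}(x,(M_1~M_2))=((\mathsf{S}~\mathcal{D}(x,M_1))~\mathcal{D}(x,M_2))$. The function $\mathcal{C}$ on $\Lambda_{vr}$ is defined by: - $\mathcal{C}(x)=x$; - $\mathcal{C}(a_f)=a_f$; - $\mathcal{C}((M_1~M_2))=(\mathcal{C}(M_1)~\mathcal{C}(M_2))$; - $\mathcal{C}(\lambda x.M)=\mathcal{D}(x,\mathcal{C}(M))$. (Every $\mathcal{C}(M)$ lies in the class of terms on which $\mathcal{D}(x,\cdot)$ is defined.) *)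

theory Defs
  imports "HOL-Library.Infinite_Typeclass"
begin

text \<open>Terms are raw: they are not identified up to renaming of bound variables.\<close>

datatype ('v, 'c) val = Var 'v | Lam 'v "('v, 'c) trm" | Con 'c
     and ('v, 'c) trm = Val "('v, 'c) val" | App "('v, 'c) trm" "('v, 'c) trm"

primrec fvv :: "('v, 'c) val \<Rightarrow> 'v set" and fv :: "('v, 'c) trm \<Rightarrow> 'v set" where
  "fvv (Var x) = {x}"
| "fvv (Lam x M) = fv M - {x}"
| "fvv (Con a) = {}"
| "fv (Val V) = fvv V"
| "fv (App M N) = fv M \<union> fv N"

text \<open>
  \<open>subst V x M\<close> is $[V/x]M$. A binder is renamed only if it would otherwise capture a free variable
  of \<open>V\<close>; the new name is an unspecified variable that is fresh for \<open>V\<close> and for the body, which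
  exists when the type of variables is infinite.
\<close>

function (sequential)
  substv :: "('v, 'c) val \<Rightarrow> 'v \<Rightarrow> ('v, 'c) val \<Rightarrow> ('v, 'c) val" and
  subst :: "('v, 'c) val \<Rightarrow> 'v \<Rightarrow> ('v, 'c) trm \<Rightarrow> ('v, 'c) trm" where
  "substv V x (Var y) = (if y = x then V else Var y)"
| "substv V x (Lam y M) =
    (if y = x then Lam y M
     else if y \<notin> fvv V \<or> x \<notin> fv M then Lam y (subst V x M)
     else let z = (SOME z. z \<notin> fvv V \<union> fv M) in Lam z (subst V x (subst (Var z) y M)))"
| "substv V x (Con a) = Con a"
| "subst V x (Val W) = Val (substv V x W)"
| "subst V x (App M N) = App (subst V x M) (subst V x N)"
  by pat_completeness auto

lemma
  substv_size_aux: "substv_subst_dom (Inl (V, x, W)) \<Longrightarrow> \<forall>z. V = Var z \<longrightarrow> size (substv V x W) = size W"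
  and subst_size_aux: "substv_subst_dom (Inr (V, x, M)) \<Longrightarrow> \<forall>z. V = Var z \<longrightarrow> size (subst V x M) = size M"
proof (induction rule: substv_subst.pinduct)
  case (2 V x y M)
  then show ?case by (auto simp: substv.psimps Let_def)
qed (auto simp: substv.psimps subst.psimps)

termination
  by (relation "measure (\<lambda>p. case p of Inl (V, x, W) \<Rightarrow> size W | Inr (V, x, M) \<Rightarrow> size M)")
    (auto simp: subst_size_aux)

text \<open>
  An external function maps a value and a store to a value and a store. It is total, since \<open>\<delta>\<close>
  below is an arbitrary function of this type.
\<close>

type_synonym ('v, 'c, 's) ext = "'c \<Rightarrow> ('v, 'c) val \<times> 's \<Rightarrow> ('v, 'c) val \<times> 's"

inductive red ::
  "('v, 'c, 's) ext \<Rightarrow> ('v, 'c) trm \<times> 's \<Rightarrow> ('v, 'c) trm \<times> 's \<Rightarrow> bool"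
  (\<open>_ \<turnstile> _ \<longrightarrow>r _\<close> [51, 51, 51] 50)
  for \<delta> :: "('v, 'c, 's) ext" where
  beta: "\<delta> \<turnstile> (App (Val (Lam x M)) (Val V), \<sigma>) \<longrightarrow>r (subst V x M, \<sigma>)"
| left: "\<delta> \<turnstile> (M1, \<sigma>1) \<longrightarrow>r (M2, \<sigma>2) \<Longrightarrow> \<delta> \<turnstile> (App M1 M, \<sigma>1) \<longrightarrow>r (App M2 M, \<sigma>2)"
| right: "\<delta> \<turnstile> (M1, \<sigma>1) \<longrightarrow>r (M2, \<sigma>2) \<Longrightarrow>
    \<delta> \<turnstile> (App (Val V) M1, \<sigma>1) \<longrightarrow>r (App (Val V) M2, \<sigma>2)"
| delta: "(V2, \<sigma>2) = \<delta> a (V1, \<sigma>1) \<Longrightarrow> \<delta> \<turnstile> (App (Val (Con a)) (Val V1), \<sigma>1) \<longrightarrow>r (Val V2, \<sigma>2)"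

inductive equivalent :: "('v, 'c, 's) ext \<Rightarrow> ('v, 'c) trm \<Rightarrow> ('v, 'c) trm \<Rightarrow> bool"
  (\<open>_ \<turnstile> _ \<simeq> _\<close> [51, 51, 51] 50)
  for \<delta> :: "('v, 'c, 's) ext" where
  refl: "\<delta> \<turnstile> M \<simeq> M"
| sym: "\<delta> \<turnstile> M \<simeq> N \<Longrightarrow> \<delta> \<turnstile> N \<simeq> M"
| trans: "\<delta> \<turnstile> M1 \<simeq> M2 \<Longrightarrow> \<delta> \<turnstile> M2 \<simeq> M3 \<Longrightarrow> \<delta> \<turnstile> M1 \<simeq> M3"
| compat_left: "\<delta> \<turnstile> M1 \<simeq> M2 \<Longrightarrow> \<delta> \<turnstile> App M1 N \<simeq> App M2 N"
| compat_right: "\<delta> \<turnstile> M1 \<simeq> M2 \<Longrightarrow> \<delta> \<turnstile> App N M1 \<simeq> App N M2"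
| beta_eq: "(\<And>\<sigma>. \<delta> \<turnstile> (M1, \<sigma>) \<longrightarrow>r (M2, \<sigma>)) \<Longrightarrow> \<delta> \<turnstile> M1 \<simeq> M2"
| xi: "\<delta> \<turnstile> M1 \<simeq> M2 \<Longrightarrow> \<delta> \<turnstile> Val (Lam x M1) \<simeq> Val (Lam x M2)"
| zeta: "\<delta> \<turnstile> App (Val (Lam x1 M1)) (Val (Var y)) \<simeq> App (Val (Lam x2 M2)) (Val (Var y)) \<Longrightarrow>
    y \<notin> fvv (Lam x1 M1) \<Longrightarrow> y \<notin> fvv (Lam x2 M2) \<Longrightarrow>
    \<delta> \<turnstile> Val (Lam x1 M1) \<simeq> Val (Lam x2 M2)"

text \<open>Below, \<open>x y z\<close> are the three particular variables used to write the combinators.\<close>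

definition combI :: "'v \<Rightarrow> ('v, 'c) val" where
  "combI x = Lam x (Val (Var x))"

definition combK :: "'v \<Rightarrow> 'v \<Rightarrow> ('v, 'c) val" where
  "combK x y = Lam x (Val (Lam y (Val (Var x))))"

definition combS :: "'v \<Rightarrow> 'v \<Rightarrow> 'v \<Rightarrow> ('v, 'c) val" where
  "combS x y z = Lam x (Val (Lam y (Val (Lam z
     (App (App (Val (Var x)) (Val (Var z))) (App (Val (Var y)) (Val (Var z))))))))"

inductive comb_trm :: "'v \<Rightarrow> 'v \<Rightarrow> 'v \<Rightarrow> ('v, 'c) trm \<Rightarrow> bool" for x y z where
  "comb_trm x y z (Val (Var w))"
| "comb_trm x y z (Val (Con a))"
| "comb_trm x y z (Val (combI x))"
| "comb_trm x y z (Val (combK x y))"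
| "comb_trm x y z (Val (combS x y z))"
| "comb_trm x y z M \<Longrightarrow> comb_trm x y z N \<Longrightarrow> comb_trm x y z (App M N)"

text \<open>
  \<open>elim x y z v M\<close> is $\mathcal{D}(v, M)$, which is only defined if \<open>comb_trm x y z M\<close>. It is left
  unspecified otherwise; lemma \<open>comb_trm_fa_vb\<close> below shows that this case never arises in \<open>fa_vb\<close>.
\<close>

fun elim :: "'v \<Rightarrow> 'v \<Rightarrow> 'v \<Rightarrow> 'v \<Rightarrow> ('v, 'c) trm \<Rightarrow> ('v, 'c) trm" where
  "elim x y z v (Val (Var w)) =
     (if w = v then Val (combI x) else App (Val (combK x y)) (Val (Var w)))"
| "elim x y z v (Val (Con a)) = App (Val (combK x y)) (Val (Con a))"
| "elim x y z v (Val (Lam w M)) =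
     (if Lam w M \<in> {combI x, combK x y, combS x y z}
      then App (Val (combK x y)) (Val (Lam w M)) else undefined)"
| "elim x y z v (App M1 M2) =
     App (App (Val (combS x y z)) (elim x y z v M1)) (elim x y z v M2)"

primrec fa_vb_val :: "'v \<Rightarrow> 'v \<Rightarrow> 'v \<Rightarrow> ('v, 'c) val \<Rightarrow> ('v, 'c) trm"
  and fa_vb :: "'v \<Rightarrow> 'v \<Rightarrow> 'v \<Rightarrow> ('v, 'c) trm \<Rightarrow> ('v, 'c) trm" where
  "fa_vb_val x y z (Var w) = Val (Var w)"
| "fa_vb_val x y z (Lam w M) = elim x y z w (fa_vb x y z M)"
| "fa_vb_val x y z (Con a) = Val (Con a)"
| "fa_vb x y z (Val V) = fa_vb_val x y z V"
| "fa_vb x y z (App M1 M2) = App (fa_vb x y z M1) (fa_vb x y z M2)"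

lemma elim_comb:
  "elim x y z v (Val (combI x)) = App (Val (combK x y)) (Val (combI x))"
  "elim x y z v (Val (combK x y)) = App (Val (combK x y)) (Val (combK x y))"
  "elim x y z v (Val (combS x y z)) = App (Val (combK x y)) (Val (combS x y z))"
  by (simp_all add: combI_def combK_def combS_def)

lemma comb_trm_elim: "comb_trm x y z M \<Longrightarrow> comb_trm x y z (elim x y z v M)"
  by (induction rule: comb_trm.induct) (simp_all add: comb_trm.intros elim_comb)

lemma comb_trm_fa_vb:
  fixes V :: "('v, 'c) val" and M :: "('v, 'c) trm"
  shows "comb_trm x y z (fa_vb_val x y z V)" and "comb_trm x y z (fa_vb x y z M)"
  by (induction V and M rule: val.induct trm.induct) (simp_all add: comb_trm.intros comb_trm_elim)

end

theory Submission
  imports Defs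
begin

text \<open>
  By induction on \<open>M\<close>, using rule \<open>xi\<close> under a binder, it suffices that \<open>\<lambda>v. N\<close> is equivalent to the
  variable elimination of \<open>v\<close> in \<open>N\<close>. This holds in spite of effects because the equivalents \<open>\<lambda>v. N\<^sub>1\<close>
  and \<open>\<lambda>v. N\<^sub>2\<close> of the arguments of \<open>S\<close> are values, so that \<open>\<beta>\<close> applies to them. Renaming of
  bound variables is an instance of \<open>zeta\<close>; replacing the bound variables of the combinators by fresh
  ones at the outset makes every later substitution capture-free.
\<close>

lemma finite_fv:
  fixes V :: "('v, 'c) val" and M :: "('v, 'c) trm"
  shows "finite (fvv V)" and "finite (fv M)"
  by (induction V and M rule: val.induct trm.induct) simp_all

text \<open>A binder is renamed only if the variable being replaced occurs free in its body, so this
  is an equality of raw terms, not merely one up to renaming.\<close>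

lemma subst_fresh:
  fixes V W :: "('v, 'c) val" and M :: "('v, 'c) trm"
  shows "v \<notin> fvv W \<Longrightarrow> substv V v W = W" and "v \<notin> fv M \<Longrightarrow> subst V v M = M"
  by (induction W and M rule: val.induct trm.induct) auto

lemma obtain_fresh:
  assumes "finite (A :: 'v::infinite set)"
  obtains v where "v \<notin> A"
  using ex_new_if_finite[OF infinite_UNIV assms] by blast

lemma equivalent_App:
  assumes "\<delta> \<turnstile> M \<simeq> M'" and "\<delta> \<turnstile> N \<simeq> N'"
  shows "\<delta> \<turnstile> App M N \<simeq> App M' N'"
  using assms by (meson equivalent.trans equivalent.compat_left equivalent.compat_right)

text \<open>Contraction is possible at every store and leaves it unchanged, as
  \<open>beta_eq\<close> demands.\<close>

lemma equivalent_beta: "\<delta> \<turnstile> App (Val (Lam v M)) (Val V) \<simeq> subst V v M"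
  by (rule equivalent.beta_eq) (rule red.beta)

lemma equivalent_beta': "subst V v M = N \<Longrightarrow> \<delta> \<turnstile> App (Val (Lam v M)) (Val V) \<simeq> N"
  using equivalent_beta by metis

text \<open>Contracting both applications in \<open>zeta\<close> leaves the two bodies at a common
  fresh variable \<open>u\<close>. When these coincide, the result is renaming of a bound
  variable.\<close>

lemma equivalent_LamI:
  assumes "u \<notin> fvv (Lam v M)" and "u \<notin> fvv (Lam w N)"
    and "\<delta> \<turnstile> subst (Var u) v M \<simeq> subst (Var u) w N"
  shows "\<delta> \<turnstile> Val (Lam v M) \<simeq> Val (Lam w N)"
  using equivalent.zeta[OF _ assms(1,2)] assms(3) equivalent_beta
  by (metis equivalent.trans equivalent.sym)

lemma fvv_comb: "fvv (combI x) = {}" "fvv (combK x y) = {}" "fvv (combS x y z) = {}"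
  by (auto simp: combI_def combK_def combS_def)

lemma combI_rename: "\<delta> \<turnstile> Val (combI v) \<simeq> Val (combI (w :: 'v::infinite))"
proof -
  obtain u where "u \<notin> {v, w}" by (rule obtain_fresh[of "{v, w}"]) simp
  then show ?thesis unfolding combI_def
    by (intro equivalent_LamI[of u]) (simp_all add: equivalent.refl)
qed

text \<open>Distinctness keeps the inner binder from shadowing the outer one.\<close>

lemma combK_rename:
  fixes x y x' y' :: "'v::infinite"
  assumes "x \<noteq> y" and "x' \<noteq> y'"
  shows "\<delta> \<turnstile> Val (combK x y) \<simeq> Val (combK x' y')"
proof -
  obtain p where p: "p \<notin> {x, y, x', y'}" by (rule obtain_fresh[of "{x, y, x', y'}"]) simp
  obtain q where q: "q \<notin> {x, y, x', y', p}" by (rule obtain_fresh[of "{x, y, x', y', p}"]) simp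
  have "\<delta> \<turnstile> Val (Lam y (Val (Var p))) \<simeq> Val (Lam y' (Val (Var p)))"
    using p q by (intro equivalent_LamI[of q]) (auto simp: equivalent.refl)
  then show ?thesis
    unfolding combK_def using p assms by (intro equivalent_LamI[of p]) auto
qed

lemma combS_rename:
  fixes x y z x' y' z' :: "'v::infinite"
  assumes "distinct [x, y, z]" and "distinct [x', y', z']"
  shows "\<delta> \<turnstile> Val (combS x y z) \<simeq> Val (combS x' y' z')"
proof -
  let ?A = "{x, y, z, x', y', z'}"
  obtain p where p: "p \<notin> ?A" by (rule obtain_fresh[of ?A]) simp
  obtain q where q: "q \<notin> insert p ?A" by (rule obtain_fresh[of "insert p ?A"]) simp
  obtain r where r: "r \<notin> {p, q} \<union> ?A" by (rule obtain_fresh[of "{p, q} \<union> ?A"]) simp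
  let ?B = "\<lambda>u v w. App (App (Val (Var u)) (Val (Var w))) (App (Val (Var v)) (Val (Var w)))"
  \<comment> \<open>The binders are treated from the inside out: here the two outer variables
    already carry their fresh names \<open>p\<close> and \<open>q\<close>.\<close>
  have "\<delta> \<turnstile> Val (Lam z (?B p q z)) \<simeq> Val (Lam z' (?B p q z'))"
    using p q r by (intro equivalent_LamI[of r]) (auto simp: equivalent.refl)
  then have "\<delta> \<turnstile> Val (Lam y (Val (Lam z (?B p y z)))) \<simeq> Val (Lam y' (Val (Lam z' (?B p y' z'))))"
    using p q assms by (intro equivalent_LamI[of q]) auto
  then show ?thesis
    unfolding combS_def using p assms by (intro equivalent_LamI[of p]) auto
qed

text \<open>The argument of \<open>K\<close> is a value, so one contraction yields a constant
  abstraction, whose binder can then be changed to \<open>v\<close>.\<close>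

lemma Lam_equivalent_combK:
  fixes x y :: "'v::infinite"
  assumes "x \<noteq> y" and v: "v \<notin> fvv V"
  shows "\<delta> \<turnstile> Val (Lam v (Val V)) \<simeq> App (Val (combK x y)) (Val V)"
proof -
  obtain x' where x': "x' \<notin> fvv V" using obtain_fresh[OF finite_fv(1)] .
  have "finite (insert x' (fvv V))" by (simp add: finite_fv)
  then obtain y' where y': "y' \<notin> insert x' (fvv V)" using obtain_fresh by blast
  have "\<delta> \<turnstile> App (Val (combK x y)) (Val V) \<simeq> App (Val (combK x' y')) (Val V)"
    using assms y' by (intro equivalent.compat_left combK_rename) auto
  moreover have "\<delta> \<turnstile> App (Val (combK x' y')) (Val V) \<simeq> Val (Lam y' (Val V))"
    unfolding combK_def using y' by (intro equivalent_beta') auto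
  \<comment> \<open>Neither binder is free in \<open>V\<close>, so both bodies stay
    \<open>V\<close>; \<open>x'\<close> doubles as the fresh variable.\<close>
  moreover have "\<delta> \<turnstile> Val (Lam y' (Val V)) \<simeq> Val (Lam v (Val V))"
    using x' y' v by (intro equivalent_LamI[of x']) (auto simp: subst_fresh equivalent.refl)
  ultimately show ?thesis by (meson equivalent.trans equivalent.sym)
qed

lemma Lam_equivalent_combS:
  fixes x y z :: "'v::infinite"
  assumes xyz: "distinct [x, y, z]"
  shows "\<delta> \<turnstile> Val (Lam v (App M N)) \<simeq> App (App (Val (combS x y z)) (Val (Lam v M))) (Val (Lam v N))"
proof -
  \<comment> \<open>Keeping the abstractions opaque lets \<open>subst_fresh\<close> handle each as a
    whole until they are contracted at \<open>u\<close>.\<close>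
  define P where "P = Lam v M"
  define Q where "Q = Lam v N"
  define A where "A = fvv P \<union> fvv Q"
  have A: "finite A" by (simp add: A_def finite_fv)
  obtain x' where x': "x' \<notin> A" using obtain_fresh[OF A] .
  obtain y' where y': "y' \<notin> insert x' A" by (rule obtain_fresh[of "insert x' A"]) (simp add: A)
  obtain z' where z': "z' \<notin> {x', y'} \<union> A" by (rule obtain_fresh[of "{x', y'} \<union> A"]) (simp add: A)
  obtain u where u: "u \<notin> {x', y', z'} \<union> A"
    by (rule obtain_fresh[of "{x', y', z'} \<union> A"]) (simp add: A)
  note fresh = x' y' z' u A_def
  have "\<delta> \<turnstile> App (App (Val (combS x y z)) (Val P)) (Val Q)
      \<simeq> App (App (Val (combS x' y' z')) (Val P)) (Val Q)"
    using xyz y' z' by (intro equivalent.compat_left combS_rename) auto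
  moreover have "\<delta> \<turnstile> App (App (Val (combS x' y' z')) (Val P)) (Val Q) \<simeq> App (Val (Lam y'
      (Val (Lam z' (App (App (Val P) (Val (Var z'))) (App (Val (Var y')) (Val (Var z')))))))) (Val Q)"
    unfolding combS_def using fresh by (intro equivalent.compat_left equivalent_beta') auto
  moreover have "\<delta> \<turnstile> App (Val (Lam y'
      (Val (Lam z' (App (App (Val P) (Val (Var z'))) (App (Val (Var y')) (Val (Var z')))))))) (Val Q)
      \<simeq> Val (Lam z' (App (App (Val P) (Val (Var z'))) (App (Val Q) (Val (Var z')))))"
    using fresh by (intro equivalent_beta') (auto simp: subst_fresh)
  moreover have "\<delta> \<turnstile> Val (Lam z' (App (App (Val P) (Val (Var z'))) (App (Val Q) (Val (Var z')))))
      \<simeq> Val (Lam v (App M N))"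
  proof (rule equivalent_LamI[of u])
    have "\<delta> \<turnstile> App (App (Val P) (Val (Var u))) (App (Val Q) (Val (Var u)))
        \<simeq> subst (Var u) v (App M N)"
      unfolding P_def Q_def by (simp add: equivalent_App equivalent_beta)
    then show "\<delta> \<turnstile> subst (Var u) z' (App (App (Val P) (Val (Var z'))) (App (Val Q) (Val (Var z'))))
        \<simeq> subst (Var u) v (App M N)"
      using fresh by (simp add: subst_fresh)
  qed (use fresh in \<open>auto simp: P_def Q_def\<close>)
  ultimately show ?thesis
    unfolding P_def Q_def by (meson equivalent.trans equivalent.sym)
qed

lemma Lam_equivalent_elim:
  fixes \<delta> :: "('v::infinite, 'c, 's) ext" and x y z :: 'v
  assumes xyz: "distinct [x, y, z]" and "comb_trm x y z M"
  shows "\<delta> \<turnstile> Val (Lam v M) \<simeq> elim x y z v M"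
  using assms(2)
proof (induction rule: comb_trm.induct)
  case (1 w)
  \<comment> \<open>For \<open>w = v\<close> the identity only needs its bound variable changed to
    \<open>x\<close>; any other variable is a value without \<open>v\<close>.\<close>
  show ?case
    using xyz combI_rename[of \<delta> v x] Lam_equivalent_combK[of x y v "Var w"] by (auto simp: combI_def)
next
  case (6 M N)
  \<comment> \<open>The eliminated forms may be applications, to which \<beta> does not apply. So
    \<open>S\<close> is contracted at the abstractions, and congruence with the induction hypotheses
    exchanges them for the eliminated forms.\<close>
  have "\<delta> \<turnstile> App (App (Val (combS x y z)) (Val (Lam v M))) (Val (Lam v N)) \<simeq> elim x y z v (App M N)"
    using 6 by (simp add: equivalent_App equivalent.refl)
  with Lam_equivalent_combS[OF xyz] show ?case by (rule equivalent.trans)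
qed (use xyz in \<open>simp_all add: elim_comb Lam_equivalent_combK fvv_comb\<close>)

lemma equivalent_fa_vb:
  fixes \<delta> :: "('v::infinite, 'c, 's) ext" and V :: "('v, 'c) val" and M :: "('v, 'c) trm"
  assumes "distinct [x, y, z]"
  shows "\<delta> \<turnstile> Val V \<simeq> fa_vb_val x y z V" and "\<delta> \<turnstile> M \<simeq> fa_vb x y z M"
proof (induction V and M rule: val.induct trm.induct)
  case (Lam v M)
  then show ?case
    using equivalent.trans[OF equivalent.xi Lam_equivalent_elim[OF assms comb_trm_fa_vb(2)]] by simp
qed (simp_all add: equivalent.refl equivalent_App)

theorem theorem1:
  fixes \<delta> :: "'c \<Rightarrow> ('v::infinite, 'c) val \<times> 's \<Rightarrow> ('v, 'c) val \<times> 's"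
    and x y z :: 'v
    and M :: "('v, 'c) trm"
  assumes "distinct [x, y, z]"
  shows "\<delta> \<turnstile> M \<simeq> fa_vb x y z M"
  using assms by (rule equivalent_fa_vb(2))

end
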